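(* Let $\varphi$ be a $C^2$ nonautonomous dynamical system on $X\subset J\times\mathbb{R}^2$ over the two-point set $J=\{t_0,t_0+T\}$ for some $t_0\in\mathbb{R}$ and $T>0$, and let $\alpha\in\mathbb{R}$. For $x_0\in X(t_0)$ let $\lambda_1(t_0,x_0,T)\ge\lambda_2(t_0,x_0,T)$ be the finite-time Lyapunov exponents of $\varphi$ at $(t_0,x_0)$ and put $$\kappa_1:=e^{(\lambda_1(t_0,x_0,T)-\alpha)T}\ \ge\ \kappa_2:=e^{(\lambda_2(t_0,x_0,T)-\alpha)T}>0.$$ Then the finite-time metric entropy with weight $\alpha$ at $(t_0,x_0)$ is $$h^{\alpha}_{t_0}(x_0)=\begin{cases}0 & \text{if } 1\ge\kappa_1\ge\kappa_2,\\[1ex] -\dfrac1T\log\left(\dfrac2\pi\left(\arccos\sqrt{\dfrac{\kappa_1^2-1}{\kappa_1^2-\kappa_2^2}}+\dfrac1{\kappa_1\kappa_2}\arccos\left(\kappa_1\sqrt{\dfrac{1-\kappa_2^2}{\kappa_1^2-\kappa_2^2}}\right)\right)\right) & \text{if }\kappa_1>1>\kappa_2,\\[2ex] -\dfrac1T\log\dfrac1{\kappa_1\kappa_2} & \text{if }\kappa_1\ge\kappa_2\ge1.\end{cases}$$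
   Context: Let $J=\{t_0,t_0+T\}$, $T>0$, let $X(t)$, $t\in J$, be open subsets of $\mathbb{R}^n$ (here $n=2$) and $X:=\{(t,x)\in J\times\mathbb{R}^n: x\in X(t)\}$. A $C^2$ nonautonomous dynamical system (NDS) $\varphi$ on $X$ over $J$ is a family of $C^2$ maps $\varphi(t,s):X(s)\to X(t)$, $t,s\in J$, with $\varphi(s,s)x=x$ and $\varphi(t,u)\varphi(u,s)x=\varphi(t,s)x$ for all $t,u,s\in J$, $x\in X(s)$. (So $\varphi(t_0+T,t_0):X(t_0)\to X(t_0+T)$ is a $C^2$ diffeomorphism.) $\|\cdot\|$ is the Euclidean norm, $\mu$ is $n$-dimensional Lebesgue measure, $B(x_0,\varepsilon):=\{x\in\mathbb{R}^n:\|x-x_0\|\le\varepsilon\}$. For $\alpha\in\mathbb{R}$, $x_0\in X(t_0)$, $\varepsilon\ge0$ let $$B^{\alpha}_{t_0}(x_0,\varepsilon):=\Big\{x\in X(t_0):\sup_{t\in J}\|\varphi(t,t_0)x-\varphi(t,t_0)x_0\|e^{-\alpha(t-t_0)}\le\varepsilon\Big\}.$$ The finite-time metric entropy (FTME) with weight $\alpha$ at $(t_0,x_0)$ is (with $|J|=\max J-\min J=T$) $$h^{\alpha}_{t_0}(x_0):=\limsup_{\varepsilon\to0^+}-\frac1{|J|}\log\frac{\mu(B^{\alpha}_{t_0}(x_0,\varepsilon))}{\mu(B(x_0,\varepsilon))}.$$ The finite-time Lyapunov exponents of $\varphi$ at $(t_0,x_0)$ are $\lambda_i(t_0,x_0,T):=\frac1T\log\Lambda_i(t_0,x_0,T)$,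 where $\Lambda_1\ge\dots\ge\Lambda_n>0$ are the singular values of the derivative $D\varphi(t_0+T,t_0)(x_0)$ of $x\mapsto\varphi(t_0+T,t_0)x$ at $x_0$. *)

theory Defs
  imports "HOL-Analysis.Analysis" "HOL-Library.Multiset"
begin

(* Intended for open S, so that the unrestricted filter "at x" is the right one. *)
definition C2_on :: "('a::real_normed_vector \<Rightarrow> 'b::real_normed_vector) \<Rightarrow> 'a set \<Rightarrow> bool" where
  "C2_on f S \<longleftrightarrow>
     (\<exists>(f' :: 'a \<Rightarrow> 'a \<Rightarrow>\<^sub>L 'b) (f'' :: 'a \<Rightarrow> 'a \<Rightarrow>\<^sub>L ('a \<Rightarrow>\<^sub>L 'b)).
        (\<forall>x\<in>S. (f has_derivative blinfun_apply (f' x)) (at x)) \<and>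
        (\<forall>x\<in>S. (f' has_derivative blinfun_apply (f'' x)) (at x)) \<and>
        continuous_on S f'')"

(* X is given by its fibres X t, and \<phi> t s is the map X s \<rightarrow> X t. The values of X outside J and
   of \<phi> t s outside X s are irrelevant. *)
definition C2_nds ::
  "real set \<Rightarrow> (real \<Rightarrow> 'a::euclidean_space set) \<Rightarrow> (real \<Rightarrow> real \<Rightarrow> 'a \<Rightarrow> 'a) \<Rightarrow> bool" where
  "C2_nds J X \<phi> \<longleftrightarrow>
     (\<forall>t\<in>J. open (X t)) \<and>
     (\<forall>t\<in>J. \<forall>s\<in>J. \<phi> t s \<in> X s \<rightarrow> X t) \<and>
     (\<forall>t\<in>J. \<forall>s\<in>J. C2_on (\<phi> t s) (X s)) \<and>
     (\<forall>s\<in>J. \<forall>x\<in>X s. \<phi> s s x = x) \<and>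
     (\<forall>t\<in>J. \<forall>u\<in>J. \<forall>s\<in>J. \<forall>x\<in>X s. \<phi> t u (\<phi> u s x) = \<phi> t s x)"

definition dyn_ball ::
  "real set \<Rightarrow> (real \<Rightarrow> 'a::euclidean_space set) \<Rightarrow> (real \<Rightarrow> real \<Rightarrow> 'a \<Rightarrow> 'a) \<Rightarrow>
   real \<Rightarrow> real \<Rightarrow> 'a \<Rightarrow> real \<Rightarrow> 'a set" where
  "dyn_ball J X \<phi> \<alpha> t0 x0 \<epsilon> =
     {x \<in> X t0. (SUP t\<in>J. norm (\<phi> t t0 x - \<phi> t t0 x0) * exp (- \<alpha> * (t - t0))) \<le> \<epsilon>}"

(* Finite-time metric entropy for finite J containing t0. If x0 lies in X t0, then for \<epsilon> > 0 the set dyn_ball is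
   Borel, contains a neighbourhood of x0 and is contained in cball x0 \<epsilon>, so the logarithm
   has a positive finite argument. *)
definition ftme ::
  "real set \<Rightarrow> (real \<Rightarrow> 'a::euclidean_space set) \<Rightarrow> (real \<Rightarrow> real \<Rightarrow> 'a \<Rightarrow> 'a) \<Rightarrow>
   real \<Rightarrow> real \<Rightarrow> 'a \<Rightarrow> ereal" where
  "ftme J X \<phi> \<alpha> t0 x0 =
     Limsup (at_right 0) (\<lambda>\<epsilon>. ereal (- (1 / (Max J - Min J)) *
       ln (measure lebesgue (dyn_ball J X \<phi> \<alpha> t0 x0 \<epsilon>) / measure lebesgue (cball x0 \<epsilon>))))"

definition singular_space ::
  "('a::euclidean_space \<Rightarrow> 'b::euclidean_space) \<Rightarrow> real \<Rightarrow> 'a set" where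
  "singular_space f \<sigma> = {v. adjoint f (f v) = \<sigma>\<^sup>2 *\<^sub>R v}"

(* For linear f: the square roots of the eigenvalues of adjoint f \<circ> f in decreasing order.
   Multiplicities are dimensions of eigenspaces, which agree with the algebraic
   multiplicities since adjoint f \<circ> f is self-adjoint. *)
definition singular_values ::
  "('a::euclidean_space \<Rightarrow> 'b::euclidean_space) \<Rightarrow> real list" where
  "singular_values f =
     rev (sorted_list_of_multiset
       (\<Sum>\<sigma> | 0 \<le> \<sigma> \<and> singular_space f \<sigma> \<noteq> {0}. replicate_mset (dim (singular_space f \<sigma>)) \<sigma>))"

(* The index i ranges over 1, ..., n, where n is the dimension of the space. *)
definition ftle ::
  "(real \<Rightarrow> real \<Rightarrow> 'a::euclidean_space \<Rightarrow> 'a) \<Rightarrow> nat \<Rightarrow> real \<Rightarrow> 'a \<Rightarrow> real \<Rightarrow> real" where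
  "ftle \<phi> i t0 x0 T =
     1 / T * ln (singular_values (frechet_derivative (\<phi> (t0 + T) t0) (at x0)) ! (i - 1))"

end

theory Submission
  imports Defs
begin

text \<open>
  Differentiability of \<open>f = \<phi> (t0 + T) t0\<close> at \<open>x0\<close> sandwiches the dynamical ball between
  \<open>x0 + (1 - \<delta>) \<epsilon> S\<close> and \<open>x0 + (1 + \<delta>) \<epsilon> S\<close>, where \<open>S\<close> is the set of \<open>v\<close> with \<open>norm v \<le> 1\<close> and
  \<open>exp (- \<alpha> T) * norm (A v) \<le> 1\<close> for the derivative \<open>A\<close>. Hence the limsup is a limit, governed by
  the area of \<open>S\<close>. In a right singular basis of \<open>A\<close>, \<open>S\<close> is the intersection of the unit disk with
  an ellipse of semi-axes \<open>1 / \<kappa>1\<close> and \<open>1 / \<kappa>2\<close>.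
\<close>

section \<open>Volume asymptotics of small dynamical balls\<close>

text \<open>Scaling by a factor \<open>r\<close> multiplies the measure of the limit shape and of
  the unit ball alike by \<open>r ^ n\<close>, so powers of \<epsilon> cancel in the quotient and
  only the relative linearisation error remains. Continuity on \<open>U\<close> makes the sets
  measurable.\<close>

lemma tendsto_measure_ratio_ball_inter:
  fixes f :: "'a::euclidean_space \<Rightarrow> 'b::euclidean_space"
  assumes U: "open U" "x0 \<in> U" and cont: "continuous_on U f"
    and deriv: "(f has_derivative A) (at x0)" and c: "c > 0"
  shows "((\<lambda>\<epsilon>. measure lebesgue {x \<in> U. norm (x - x0) \<le> \<epsilon> \<and> c * norm (f x - f x0) \<le> \<epsilon>}
             / measure lebesgue (cball x0 \<epsilon>)) \<longlongrightarrow>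
         measure lebesgue {v. norm v \<le> 1 \<and> c * norm (A v) \<le> 1} / measure lebesgue (cball (0::'a) 1))
         (at_right 0)"
proof -
  define D where "D \<epsilon> = {x \<in> U. norm (x - x0) \<le> \<epsilon> \<and> c * norm (f x - f x0) \<le> \<epsilon>}" for \<epsilon>
  define S where "S = {v. norm v \<le> 1 \<and> c * norm (A v) \<le> 1}"
  define n where "n = DIM('a)"
  define b where "b = measure lebesgue (cball (0::'a) 1)"
  define m where "m = measure lebesgue S / b"
  define q where "q \<epsilon> = measure lebesgue (D \<epsilon>) / measure lebesgue (cball x0 \<epsilon>)" for \<epsilon>
  interpret A: bounded_linear A
    using deriv by (rule has_derivative_bounded_linear)
  have A_scale: "norm (A (r *\<^sub>R v)) = r * norm (A v)" if "r \<ge> 0" for r v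
    using that by (simp add: A.scaleR)
  have b_pos: "b > 0"
    by (simp add: b_def content_cball_pos)
  have ball: "measure lebesgue (cball x0 r) = r ^ n * b" if "r > 0" for r
    using that by (simp add: n_def b_def content_cball)
  have "closed S"
    unfolding S_def by (intro closed_Collect_conj closed_Collect_le continuous_intros
        continuous_on_id A.continuous_on)
  moreover have "bounded S"
    by (rule bounded_subset[of "cball 0 1"]) (auto simp: S_def)
  ultimately have S_compact: "compact S"
    by (simp add: compact_eq_bounded_closed)
  have affine_meas: "(\<lambda>v. r *\<^sub>R v + x0) ` S \<in> lmeasurable" for r
    by (intro lmeasurable_compact compact_continuous_image S_compact continuous_intros)
  have affine: "measure lebesgue ((\<lambda>v. r *\<^sub>R v + x0) ` S) = r ^ n * measure lebesgue S" if "r \<ge> 0" for r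
    unfolding n_def using measure_lebesgue_affine[of r x0 S] that by simp
  \<comment> \<open>For fixed \<delta>, the inner and outer copies of \<open>S\<close> have scaling
    factors \<open>(1 - \<delta>) * \<epsilon>\<close> and
    \<open>(1 + \<delta>) * \<epsilon>\<close>; the factor \<epsilon> disappears on division by the
    measure of the ball.\<close>
  have bounds: "eventually (\<lambda>\<epsilon>. (1 - \<delta>) ^ n * m \<le> q \<epsilon> \<and> q \<epsilon> \<le> (1 + \<delta>) ^ n * m) (at_right 0)"
    if \<delta>: "0 < \<delta>" "\<delta> < 1" for \<delta>
  proof -
    \<comment> \<open>The tolerance \<delta> / c turns into \<delta> once the error is multiplied by
      the weight \<open>c\<close>.\<close>
    have "\<delta> / c > 0" using \<delta> c by simp
    then obtain d1 where d1: "d1 > 0"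
      "\<And>x. norm (x - x0) < d1 \<Longrightarrow> norm (f x - f x0 - A (x - x0)) \<le> (\<delta> / c) * norm (x - x0)"
      using deriv unfolding has_derivative_at_alt by meson
    obtain d2 where d2: "d2 > 0" "cball x0 d2 \<subseteq> U"
      using U open_contains_cball by metis
    have "eventually (\<lambda>\<epsilon>. 0 < \<epsilon> \<and> \<epsilon> < min d1 d2) (at_right (0::real))"
      using eventually_at_right_real[of 0 "min d1 d2"] d1(1) d2(1) by simp
    then show ?thesis
    proof eventually_elim
      case (elim \<epsilon>)
      then have \<epsilon>: "\<epsilon> > 0" "\<epsilon> < d1" "\<epsilon> < d2" by auto
      have err: "c * norm (f x - f x0 - A (x - x0)) \<le> \<delta> * norm (x - x0)" if "norm (x - x0) \<le> \<epsilon>" for x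
        using d1(2)[of x] that \<epsilon> c by (simp add: field_simps)
      have in_U: "x \<in> U" if "norm (x - x0) \<le> \<epsilon>" for x
        using d2(2) that \<epsilon> by (auto simp: dist_norm norm_minus_commute subset_iff)
      have D_eq: "D \<epsilon> = cball x0 \<epsilon> \<inter> {x \<in> cball x0 \<epsilon>. c * norm (f x - f x0) \<le> \<epsilon>}"
        using in_U by (auto simp: D_def dist_norm norm_minus_commute)
      have "closed (D \<epsilon>)"
        unfolding D_eq
        by (intro closed_Int closed_cball continuous_closed_preimage_constant continuous_on_closed_Collect_le
            continuous_intros continuous_on_subset[OF cont]) (use in_U in \<open>auto simp: dist_norm norm_minus_commute\<close>)
      moreover have "bounded (D \<epsilon>)"
        unfolding D_eq by (rule bounded_subset[of "cball x0 \<epsilon>"]) auto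
      ultimately have D_meas: "D \<epsilon> \<in> lmeasurable"
        by (simp add: lmeasurable_compact compact_eq_bounded_closed)
      \<comment> \<open>Outer inclusion: replacing \<open>f x - f x0\<close> by
        \<open>A (x - x0)\<close> costs at most \<delta> * \<epsilon>, which the larger radius
        absorbs.\<close>
      have "D \<epsilon> \<subseteq> (\<lambda>v. ((1 + \<delta>) * \<epsilon>) *\<^sub>R v + x0) ` S"
      proof
        fix x assume x: "x \<in> D \<epsilon>"
        define r where "r = (1 + \<delta>) * \<epsilon>"
        define v where "v = (1 / r) *\<^sub>R (x - x0)"
        have r: "r > 0" using \<delta> \<epsilon> by (simp add: r_def)
        have nx: "norm (x - x0) \<le> \<epsilon>" "c * norm (f x - f x0) \<le> \<epsilon>"
          using x by (auto simp: D_def)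
        have "c * norm (A (x - x0)) \<le> c * norm (f x - f x0) + c * norm (f x - f x0 - A (x - x0))"
          using c norm_triangle_sub[of "A (x - x0)" "f x - f x0"]
          by (simp add: norm_minus_commute flip: distrib_left)
        also have "\<dots> \<le> \<epsilon> + \<delta> * \<epsilon>"
          using nx err[OF nx(1)] \<delta> by (smt (verit) mult_left_mono)
        finally have "c * norm (A (x - x0)) \<le> r" by (simp add: r_def algebra_simps)
        moreover have "norm (x - x0) \<le> r"
          using nx \<delta> \<epsilon> by (simp add: r_def algebra_simps add_increasing2)
        ultimately have "v \<in> S"
          using r A_scale[of "1 / r" "x - x0"] by (simp add: S_def v_def divide_le_eq del: scaleR_diff_right)
        moreover have "x = ((1 + \<delta>) * \<epsilon>) *\<^sub>R v + x0"
          using r by (simp add: v_def flip: r_def)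
        ultimately show "x \<in> (\<lambda>v. ((1 + \<delta>) * \<epsilon>) *\<^sub>R v + x0) ` S" by blast
      qed
      then have "measure lebesgue (D \<epsilon>) \<le> ((1 + \<delta>) * \<epsilon>) ^ n * measure lebesgue S"
        using measure_mono_fmeasurable[OF _ _ affine_meas] D_meas affine[of "(1 + \<delta>) * \<epsilon>"] \<delta> \<epsilon>
        by (metis add_nonneg_nonneg fmeasurableD less_eq_real_def mult_nonneg_nonneg zero_le_one)
      \<comment> \<open>Inner inclusion: the radius is shrunk by exactly \<delta> * \<epsilon>,
        which leaves room for the linearisation error.\<close>
      moreover have "(\<lambda>v. ((1 - \<delta>) * \<epsilon>) *\<^sub>R v + x0) ` S \<subseteq> D \<epsilon>"
      proof clarify
        fix v assume v: "v \<in> S"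
        define x where "x = ((1 - \<delta>) * \<epsilon>) *\<^sub>R v + x0"
        have r: "(1 - \<delta>) * \<epsilon> \<ge> 0" "(1 - \<delta>) * \<epsilon> \<le> \<epsilon>" using \<delta> \<epsilon> by (auto simp: algebra_simps)
        have "norm (x - x0) = (1 - \<delta>) * \<epsilon> * norm v"
          using r(1) by (simp only: x_def add_diff_cancel_right' norm_scaleR abs_of_nonneg)
        also have "\<dots> \<le> (1 - \<delta>) * \<epsilon>"
          using r v by (auto simp: S_def intro: mult_left_le)
        finally have nx: "norm (x - x0) \<le> (1 - \<delta>) * \<epsilon>" .
        have "c * norm (A (x - x0)) = (1 - \<delta>) * \<epsilon> * (c * norm (A v))"
          using r by (simp add: x_def A_scale)
        also have "\<dots> \<le> (1 - \<delta>) * \<epsilon>"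
          using r v by (auto simp: S_def intro: mult_left_le)
        finally have nA: "c * norm (A (x - x0)) \<le> (1 - \<delta>) * \<epsilon>" .
        have "c * norm (f x - f x0) \<le> c * norm (A (x - x0)) + c * norm (f x - f x0 - A (x - x0))"
          using c norm_triangle_sub[of "f x - f x0" "A (x - x0)"]
          by (simp flip: distrib_left)
        also have "\<dots> \<le> (1 - \<delta>) * \<epsilon> + \<delta> * \<epsilon>"
          using nA err[of x] nx r \<delta> by (smt (verit) mult_left_mono)
        finally have "c * norm (f x - f x0) \<le> \<epsilon>" by (simp add: algebra_simps)
        then show "((1 - \<delta>) * \<epsilon>) *\<^sub>R v + x0 \<in> D \<epsilon>"
          using nx r in_U[of x] by (auto simp: D_def x_def)
      qed
      then have "((1 - \<delta>) * \<epsilon>) ^ n * measure lebesgue S \<le> measure lebesgue (D \<epsilon>)"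
        using measure_mono_fmeasurable[OF _ _ D_meas] affine_meas affine[of "(1 - \<delta>) * \<epsilon>"] \<delta> \<epsilon>
        by (metis diff_ge_0_iff_ge fmeasurableD less_eq_real_def mult_nonneg_nonneg)
      moreover have "measure lebesgue (D \<epsilon>) = \<epsilon> ^ n * (b * q \<epsilon>)"
        using \<epsilon>(1) b_pos by (simp only: q_def ball[OF \<epsilon>(1)]) simp
      ultimately show ?case
        using \<epsilon>(1) b_pos
        by (simp add: m_def power_mult_distrib mult.left_commute[of _ "\<epsilon> ^ n"] mult.assoc pos_le_divide_eq
            pos_divide_le_eq mult.commute)
    qed
  qed
  have lim_up: "((\<lambda>\<delta>. (1 + \<delta>) ^ n * m) \<longlongrightarrow> m) (at_right 0)"
    and lim_lo: "((\<lambda>\<delta>. (1 - \<delta>) ^ n * m) \<longlongrightarrow> m) (at_right 0)"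
    by (rule tendsto_eq_intros refl | simp)+
  have unit: "eventually (\<lambda>\<delta>. 0 < \<delta> \<and> \<delta> < 1) (at_right (0::real))"
    using eventually_at_right_real[of 0 1] by simp
  \<comment> \<open>First \<delta> is fixed so small that the factor with \<delta> still respects
    the strict bound \<open>a\<close>; only then does \<epsilon> tend to 0.\<close>
  have "(q \<longlongrightarrow> m) (at_right 0)"
  proof (rule order_tendstoI)
    fix a assume "a < m"
    then have "eventually (\<lambda>\<delta>. a < (1 - \<delta>) ^ n * m) (at_right 0)"
      using lim_lo order_tendstoD(1) by blast
    then obtain \<delta> where "0 < \<delta>" "\<delta> < 1" "a < (1 - \<delta>) ^ n * m"
      using eventually_happens[OF eventually_conj[OF unit]] trivial_limit_at_right_real by blast
    then show "eventually (\<lambda>\<epsilon>. a < q \<epsilon>) (at_right 0)"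
      using bounds[of \<delta>] by (auto elim: eventually_mono)
  next
    fix a assume "m < a"
    then have "eventually (\<lambda>\<delta>. (1 + \<delta>) ^ n * m < a) (at_right 0)"
      using lim_up order_tendstoD(2) by blast
    then obtain \<delta> where "0 < \<delta>" "\<delta> < 1" "(1 + \<delta>) ^ n * m < a"
      using eventually_happens[OF eventually_conj[OF unit]] trivial_limit_at_right_real by blast
    then show "eventually (\<lambda>\<epsilon>. q \<epsilon> < a) (at_right 0)"
      using bounds[of \<delta>] by (auto elim: eventually_mono)
  qed
  then show ?thesis
    by (simp add: q_def [abs_def] m_def b_def D_def S_def)
qed

section \<open>Right singular bases and singular values in the plane\<close>

text \<open>Orthonormal bases are parametrised by an angle, the second vector being
  \<open>rot_basis (\<theta> + pi/2)\<close>. This gives a continuous one-parameter family to which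
  the intermediate value theorem applies.\<close>

definition rot_basis :: "real \<Rightarrow> real^2" where
  "rot_basis \<theta> = vector [cos \<theta>, sin \<theta>]"

text \<open>The rotation by \<theta>, written so that the components of \<open>v\<close> are the
  coordinates in the rotated basis.\<close>

definition rot_map :: "real \<Rightarrow> real^2 \<Rightarrow> real^2" where
  "rot_map \<theta> v = v$1 *\<^sub>R rot_basis \<theta> + v$2 *\<^sub>R rot_basis (\<theta> + pi/2)"

lemma inner_rot_basis [simp]:
  "rot_basis \<theta> \<bullet> rot_basis \<theta> = 1"
  "rot_basis (\<theta> + pi/2) \<bullet> rot_basis (\<theta> + pi/2) = 1"
  "rot_basis \<theta> \<bullet> rot_basis (\<theta> + pi/2) = 0"
  "rot_basis (\<theta> + pi/2) \<bullet> rot_basis \<theta> = 0"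
  by (simp_all add: rot_basis_def inner_vec_def sum_2 cos_add sin_add flip: power2_eq_square)

lemma linear_rot_map: "linear (rot_map \<theta>)"
  by (rule linearI) (simp_all add: rot_map_def algebra_simps)

lemma inner_rot_map: "rot_map \<theta> v \<bullet> rot_map \<theta> w = v \<bullet> w"
  by (simp add: rot_map_def inner_add_left inner_add_right inner_vec_def[of v w] sum_2)

lemma orthogonal_transformation_rot_map: "orthogonal_transformation (rot_map \<theta>)"
  by (simp add: orthogonal_transformation_def linear_rot_map inner_rot_map)

lemma rot_basis_add_half_pi_twice [simp]: "rot_basis (\<theta> + pi/2 + pi/2) = - rot_basis \<theta>"
  by (simp add: rot_basis_def vec_eq_iff forall_2 cos_add sin_add)

lemma continuous_on_rot_basis [continuous_intros]:
  fixes f :: "'a::t2_space \<Rightarrow> real"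
  assumes "continuous_on S f"
  shows "continuous_on S (\<lambda>x. rot_basis (f x))"
proof -
  have "rot_basis (f x) = cos (f x) *\<^sub>R axis 1 1 + sin (f x) *\<^sub>R axis 2 1" for x
    by (simp add: rot_basis_def vec_eq_iff forall_2 axis_def)
  then show ?thesis by (auto intro!: continuous_on_cos continuous_on_sin continuous_on_add continuous_on_scaleR continuous_on_const assms)
qed

text \<open>The inner product of the images of an orthonormal pair changes sign when the pair is rotated by
  a right angle, so the intermediate value theorem yields a right singular basis.\<close>

lemma exists_orthogonal_image_basis:
  fixes A :: "real^2 \<Rightarrow> 'b::euclidean_space"
  assumes "linear A"
  obtains \<theta> where "A (rot_basis \<theta>) \<bullet> A (rot_basis (\<theta> + pi/2)) = 0"
    and "norm (A (rot_basis \<theta>)) \<ge> norm (A (rot_basis (\<theta> + pi/2)))"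
proof -
  define g where "g \<theta> = A (rot_basis \<theta>) \<bullet> A (rot_basis (\<theta> + pi/2))" for \<theta>
  have neg: "g (\<theta> + pi/2) = - g \<theta>" for \<theta>
    by (simp only: g_def rot_basis_add_half_pi_twice linear_neg[OF assms] inner_minus_right inner_commute[of _ "A (rot_basis (\<theta> + pi/2))"])
  have "continuous_on UNIV g"
    unfolding g_def
    by (intro continuous_intros linear_continuous_on_compose[OF _ assms])
  then have cont: "continuous_on {0..pi/2} g"
    by (rule continuous_on_subset) simp
  obtain \<theta> where \<theta>: "g \<theta> = 0"
  proof (cases "g 0 \<le> 0")
    case True
    then show ?thesis using IVT'[of g 0 0 "pi/2"] cont neg[of 0] that by auto
  next
    case False
    then show ?thesis using IVT2'[of g "pi/2" 0 0] cont neg[of 0] that by auto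
  qed
  \<comment> \<open>If the two image norms come in the wrong order, one more turn by a right angle
    exchanges them and keeps the images orthogonal.\<close>
  show ?thesis
  proof (cases "norm (A (rot_basis \<theta>)) \<ge> norm (A (rot_basis (\<theta> + pi/2)))")
    case True
    then show ?thesis using that \<theta> by (simp add: g_def)
  next
    case False
    show ?thesis
    proof (rule that[of "\<theta> + pi/2"])
      show "A (rot_basis (\<theta> + pi/2)) \<bullet> A (rot_basis (\<theta> + pi/2 + pi/2)) = 0"
        using neg[of \<theta>] \<theta> by (simp only: g_def)
      show "norm (A (rot_basis (\<theta> + pi/2 + pi/2))) \<le> norm (A (rot_basis (\<theta> + pi/2)))"
        using False by (simp only: rot_basis_add_half_pi_twice linear_neg[OF assms] norm_minus_cancel)
    qed
  qed
qed

lemma rot_map_surjE: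
  obtains u where "v = rot_map \<theta> u"
  by (metis orthogonal_transformation_surj orthogonal_transformation_rot_map surjE)

text \<open>Orthogonality of the images removes the mixed term, so the quadratic form of
  \<open>A\<close> is diagonal in the rotated coordinates.\<close>

lemma norm_image_rot_map:
  fixes A :: "real^2 \<Rightarrow> 'b::euclidean_space"
  assumes "linear A" and "A (rot_basis \<theta>) \<bullet> A (rot_basis (\<theta> + pi/2)) = 0"
  shows "(norm (A (rot_map \<theta> u)))\<^sup>2 =
    (norm (A (rot_basis \<theta>)))\<^sup>2 * (u$1)\<^sup>2 + (norm (A (rot_basis (\<theta> + pi/2))))\<^sup>2 * (u$2)\<^sup>2"
  using assms(2) unfolding power2_norm_eq_inner
  by (simp only: rot_map_def linear_add[OF assms(1)] linear_scale[OF assms(1)] inner_add_left inner_add_right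
      inner_scaleR_left inner_scaleR_right inner_commute[of "A (rot_basis (\<theta> + pi/2))" "A (rot_basis \<theta>)"])
    (simp add: power2_eq_square)

text \<open>Orthogonality of the images makes the basis an eigenbasis of
  \<open>adjoint A \<circ> A\<close>, with the squared image norms as eigenvalues; the singular
  spaces can then be read off in coordinates.\<close>

lemma singular_values_eq_norm_rot_basis:
  fixes A :: "real^2 \<Rightarrow> 'b::euclidean_space"
  assumes lin: "linear A" and orth: "A (rot_basis \<theta>) \<bullet> A (rot_basis (\<theta> + pi/2)) = 0"
    and le: "norm (A (rot_basis \<theta>)) \<ge> norm (A (rot_basis (\<theta> + pi/2)))"
  shows "singular_values A = [norm (A (rot_basis \<theta>)), norm (A (rot_basis (\<theta> + pi/2)))]"
proof -
  define e1 e2 where "e1 = rot_basis \<theta>" "e2 = rot_basis (\<theta> + pi/2)"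
  define s1 s2 where "s1 = norm (A e1)" "s2 = norm (A e2)"
  note defs = e1_e2_def s1_s2_def
  have s: "s1 \<ge> s2" "s2 \<ge> 0"
    using le by (simp_all add: defs)
  have e: "e1 \<bullet> e1 = 1" "e2 \<bullet> e2 = 1" "e1 \<bullet> e2 = 0" "e2 \<bullet> e1 = 0"
    by (simp_all add: defs)
  then have nz: "e1 \<noteq> 0" "e2 \<noteq> 0" by auto
  have expand: "\<exists>x y. v = x *\<^sub>R e1 + y *\<^sub>R e2" for v
    by (metis rot_map_surjE[of v \<theta>] rot_map_def defs(1,2))
  have eqI: "v = w" if "v \<bullet> e1 = w \<bullet> e1" "v \<bullet> e2 = w \<bullet> e2" for v w
  proof -
    obtain x y where "v - w = x *\<^sub>R e1 + y *\<^sub>R e2" using expand by blast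
    then have "(v - w) \<bullet> (v - w) = x * ((v - w) \<bullet> e1) + y * ((v - w) \<bullet> e2)"
      by (simp only: inner_add_right inner_scaleR_right)
    then have "(v - w) \<bullet> (v - w) = 0"
      using that by (simp add: inner_diff_left)
    then show ?thesis by simp
  qed
  \<comment> \<open>Both sides are tested against the basis: moving the adjoint across leaves inner
    products of \<open>A e1\<close> and \<open>A e2\<close>, which are \<open>s1\<^sup>2\<close>,
    \<open>s2\<^sup>2\<close> or 0.\<close>
  have A1: "adjoint A (A e1) = s1\<^sup>2 *\<^sub>R e1" and A2: "adjoint A (A e2) = s2\<^sup>2 *\<^sub>R e2"
    by (rule eqI; use orth in \<open>simp add:  adjoint_clauses[OF lin] e s1_s2_def 
      power2_norm_eq_inner inner_commute flip: e1_e2_def\<close>)+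
  have lin': "linear (adjoint A)" using lin by (rule adjoint_linear)
  have space: "singular_space A \<sigma> = {x *\<^sub>R e1 + y *\<^sub>R e2 | x y. s1\<^sup>2 * x = \<sigma>\<^sup>2 * x \<and> s2\<^sup>2 * y = \<sigma>\<^sup>2 * y}" for \<sigma>
  proof -
    have "adjoint A (A (x *\<^sub>R e1 + y *\<^sub>R e2)) = \<sigma>\<^sup>2 *\<^sub>R (x *\<^sub>R e1 + y *\<^sub>R e2) \<longleftrightarrow>
        s1\<^sup>2 * x = \<sigma>\<^sup>2 * x \<and> s2\<^sup>2 * y = \<sigma>\<^sup>2 * y" (is "?l = ?r \<longleftrightarrow> _") for x y
    proof -
      have "?l = ?r \<longleftrightarrow> ?l \<bullet> e1 = ?r \<bullet> e1 \<and> ?l \<bullet> e2 = ?r \<bullet> e2"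
        using eqI by auto
      then show ?thesis
        by (simp add: linear_add[OF lin] linear_scale[OF lin] linear_add[OF lin'] linear_scale[OF lin']
          A1 A2 inner_add_left e mult.commute)
    qed
    note eigen = this
    show ?thesis
    proof (rule set_eqI)
      fix v
      obtain x y where v: "v = x *\<^sub>R e1 + y *\<^sub>R e2" using expand by blast
      have "v \<in> singular_space A \<sigma> \<longleftrightarrow> s1\<^sup>2 * x = \<sigma>\<^sup>2 * x \<and> s2\<^sup>2 * y = \<sigma>\<^sup>2 * y"
        by (simp only: v singular_space_def mem_Collect_eq eigen)
      moreover have "x' = x \<and> y' = y" if "v = x' *\<^sub>R e1 + y' *\<^sub>R e2" for x' y'
      proof -
        have "v \<bullet> e1 = x" "v \<bullet> e2 = y" by (simp_all add: v inner_add_left e)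
        then show ?thesis by (simp add: that inner_add_left e)
      qed
      ultimately show "v \<in> singular_space A \<sigma> \<longleftrightarrow>
          v \<in> {x *\<^sub>R e1 + y *\<^sub>R e2 | x y. s1\<^sup>2 * x = \<sigma>\<^sup>2 * x \<and> s2\<^sup>2 * y = \<sigma>\<^sup>2 * y}"
        using v by blast
    qed
  qed
  have iff: "s\<^sup>2 * x = \<sigma>\<^sup>2 * x \<longleftrightarrow> s = \<sigma> \<or> x = 0" if "s \<ge> 0" "\<sigma> \<ge> 0" for s \<sigma> x :: real
    using that by (auto simp: power2_eq_iff_nonneg)
  have space': "singular_space A \<sigma> = {x *\<^sub>R e1 + y *\<^sub>R e2 | x y. (s1 = \<sigma> \<or> x = 0) \<and> (s2 = \<sigma> \<or> y = 0)}"
    if "\<sigma> \<ge> 0" for \<sigma>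
    unfolding space using iff s that by simp
  \<comment> \<open>A double singular value has the whole plane as its space and is counted twice
    through \<open>dim\<close>; otherwise there are two lines, and the reversed sorting puts the
    larger value \<open>s1\<close> first.\<close>
  show ?thesis
  proof (cases "s1 = s2")
    case True
    have "singular_space A s1 = UNIV"
      using expand True s by (auto simp: space' set_eq_iff)
    moreover have "singular_space A \<sigma> = {0}" if "\<sigma> \<ge> 0" "\<sigma> \<noteq> s1" for \<sigma>
      using that True by (auto simp: space')
    ultimately have "{\<sigma>. 0 \<le> \<sigma> \<and> singular_space A \<sigma> \<noteq> {0}} = {s1}"
      using s nz by (auto simp: set_eq_iff)
    with \<open>singular_space A s1 = UNIV\<close> have "singular_values A = [s1, s1]"
      by (simp add: singular_values_def numeral_2_eq_2)
    then show ?thesis using True by (simp add: defs)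
  next
    case False
    have sp1: "singular_space A s1 = span {e1}"
      using False s by (auto simp: space' span_singleton)
    have sp2: "singular_space A s2 = span {e2}"
      using False s by (auto simp: space' span_singleton)
    have "singular_space A \<sigma> = {0}" if "\<sigma> \<ge> 0" "\<sigma> \<noteq> s1" "\<sigma> \<noteq> s2" for \<sigma>
      using that by (auto simp: space')
    then have "{\<sigma>. 0 \<le> \<sigma> \<and> singular_space A \<sigma> \<noteq> {0}} = {s1, s2}"
      using s nz sp1 sp2 by (auto simp: set_eq_iff) (metis span_base singletonI singletonD)+
    moreover have "dim (span {e1}) = 1" "dim (span {e2}) = 1"
      using nz by (simp_all add: dim_insert)
    ultimately have "singular_values A = [s1, s2]"
      using False s sp1 sp2 by (simp add: singular_values_def numeral_2_eq_2)
    then show ?thesis by (simp add: defs)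
  qed
qed

section \<open>Areas of the disk, the ellipse and their intersection\<close>

lemma measurable_vector_2 [measurable]:
  "(\<lambda>(x, y). vector [x, y] :: real^2) \<in> lborel \<Otimes>\<^sub>M lborel \<rightarrow>\<^sub>M borel"
proof -
  have vec: "(\<lambda>p. vector [fst p, snd p] :: real^2) = (\<lambda>p. fst p *\<^sub>R axis 1 1 + snd p *\<^sub>R axis 2 1)"
    by (simp add: fun_eq_iff vec_eq_iff forall_2 axis_def)
  have "(\<lambda>p. vector [fst p, snd p] :: real^2) \<in> borel_measurable (borel \<Otimes>\<^sub>M borel)"
    unfolding vec by measurable
  then show ?thesis
    by (simp add: case_prod_beta cong: measurable_cong_sets sets_pair_measure_cong)
qed

text \<open>This gives access to Tonelli's theorem for areas in \<open>real^2\<close>. Agreement on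
  boxes is enough to identify the measure.\<close>

lemma lborel_vec_2_eq_distr: "lborel = distr (lborel \<Otimes>\<^sub>M lborel) borel (\<lambda>(x, y). vector [x, y] :: real^2)"
proof (rule lborel_eqI)
  have Basis: "(Basis :: (real^2) set) = {axis 1 1, axis 2 1}"
    by (auto simp: Basis_vec_def UNIV_2)
  have neq: "axis 1 1 \<noteq> (axis 2 1 :: real^2)"
    by (simp add: axis_eq_axis)
  fix l u :: "real^2"
  assume le: "\<And>b. b \<in> Basis \<Longrightarrow> l \<bullet> b \<le> u \<bullet> b"
  have le': "l$1 \<le> u$1" "l$2 \<le> u$2"
    using le[of "axis 1 1"] le[of "axis 2 1"] by (auto simp: Basis inner_axis)
  have "(\<lambda>(x, y). vector [x, y] :: real^2) -` box l u = {l$1<..<u$1} \<times> {l$2<..<u$2}"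
    by (auto simp: mem_box_cart forall_2)
  then have "emeasure (distr (lborel \<Otimes>\<^sub>M lborel) borel (\<lambda>(x, y). vector [x, y] :: real^2)) (box l u)
      = emeasure (lborel \<Otimes>\<^sub>M lborel) ({l$1<..<u$1} \<times> {l$2<..<u$2})"
    by (subst emeasure_distr[OF measurable_vector_2]) (simp_all add: space_pair_measure)
  also have "\<dots> = ennreal (u$1 - l$1) * ennreal (u$2 - l$2)"
    using le' by (subst lborel.emeasure_pair_measure_Times) auto
  also have "\<dots> = (\<Prod>b\<in>Basis. (u - l) \<bullet> b)"
    using le' neq by (simp add: Basis inner_axis ennreal_mult')
  finally show "emeasure (distr (lborel \<Otimes>\<^sub>M lborel) borel (\<lambda>(x, y). vector [x, y] :: real^2)) (box l u)
      = (\<Prod>b\<in>Basis. (u - l) \<bullet> b)" .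
qed simp

text \<open>With \<open>u = k * x\<close> an antiderivative is
  \<open>(u * sqrt (1 - u\<^sup>2) + arcsin u) / (2 * k)\<close>. The case \<open>k = 1\<close>
  serves the circular arc, \<open>k = a\<close> the elliptic arcs up to the vertical factor
  \<open>1 / b\<close>.\<close>

lemma has_integral_sqrt_one_minus_square:
  fixes a b k :: real
  assumes k: "k > 0" and ab: "a \<le> b" and bnd: "-1 \<le> k * a" "k * b \<le> 1"
  shows "((\<lambda>x. sqrt (1 - (k * x)\<^sup>2)) has_integral
    (k * b * sqrt (1 - (k * b)\<^sup>2) + arcsin (k * b) - (k * a * sqrt (1 - (k * a)\<^sup>2) + arcsin (k * a))) / (2 * k)) {a..b}"
proof -
  define F where "F x = (k * x * sqrt (1 - (k * x)\<^sup>2) + arcsin (k * x)) / (2 * k)" for x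
  have "((\<lambda>x. sqrt (1 - (k * x)\<^sup>2)) has_integral (F b - F a)) {a..b}"
  \<comment> \<open>An endpoint may satisfy \<open>k * x = 1\<close> or \<open>k * x = -1\<close>,
    where the derivative rules for \<open>sqrt\<close> and \<open>arcsin\<close> fail; there
    continuity suffices.\<close>
  proof (rule fundamental_theorem_of_calculus_interior)
    have "-1 \<le> k * x \<and> k * x \<le> 1" if "x \<in> {a..b}" for x
      using that k bnd by (smt (verit) atLeastAtMost_iff mult_left_mono)
    then show "continuous_on {a..b} F"
      unfolding F_def using k by (intro continuous_intros) auto
  next
    fix x assume x: "x \<in> {a<..<b}"
    have lt: "-1 < k * x" "k * x < 1"
      using x k bnd by (smt (verit) greaterThanLessThan_iff mult_strict_left_mono)+
    then have pos: "1 - (k * x)\<^sup>2 > 0"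
      by (simp add: abs_square_less_1 abs_less_iff)
    have "(F has_real_derivative sqrt (1 - (k * x)\<^sup>2)) (at x)"
    proof -
      define w where "w = sqrt (1 - (k * x)\<^sup>2)"
      have sqrt2: "sqrt (1 - k\<^sup>2 * x\<^sup>2) * sqrt (1 - k\<^sup>2 * x\<^sup>2) = 1 - k\<^sup>2 * x\<^sup>2"
        using pos by (simp add: power_mult_distrib)
      have w: "w > 0" "w * w = 1 - (k * x)\<^sup>2" using pos by (simp_all add: w_def)
      have "(F has_real_derivative (k * w + k * x * (inverse w / 2 * (- (2 * (k * x) * k))) + inverse w * k) / (2 * k)) (at x)"
        unfolding F_def w_def using lt pos k
        by (auto intro!: derivative_eq_intros simp: divide_simps) (use sqrt2 in algebra)
      moreover have "(k * w + k * x * (inverse w / 2 * (- (2 * (k * x) * k))) + inverse w * k) / (2 * k) = w"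
      proof -
        have "(k * w + k * x * (inverse w / 2 * (- (2 * (k * x) * k))) + inverse w * k) / (2 * k)
            = (w * w + (1 - (k * x)\<^sup>2)) / (2 * w)"
          using w(1) k by (simp add: field_simps power2_eq_square)
        also have "\<dots> = w" using w by (simp flip: w(2))
        finally show ?thesis .
      qed
      ultimately show ?thesis by (simp add: w_def)
    qed
    then show "(F has_vector_derivative sqrt (1 - (k * x)\<^sup>2)) (at x)"
      by (simp add: has_real_derivative_iff_has_vector_derivative)
  qed (rule ab)
  then show ?thesis by (simp add: F_def diff_divide_distrib)
qed

text \<open>The area is computed by vertical slices. The binding constraint is the circle near the
  vertical axis and the ellipse further out, up to its vertex at \<open>1 / a\<close>;
  \<open>h\<close> is the resulting half-height.\<close>

lemma measure_disk_inter_ellipse: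
  fixes a b :: real
  assumes ab: "a > 1" "0 < b" "b < 1"
  shows "measure lebesgue {v::real^2. (v$1)\<^sup>2 + (v$2)\<^sup>2 \<le> 1 \<and> a\<^sup>2 * (v$1)\<^sup>2 + b\<^sup>2 * (v$2)\<^sup>2 \<le> 1} =
    2 * (arccos (sqrt ((a\<^sup>2 - 1) / (a\<^sup>2 - b\<^sup>2))) + 1 / (a * b) * arccos (a * sqrt ((1 - b\<^sup>2) / (a\<^sup>2 - b\<^sup>2))))"
    (is "measure lebesgue ?S = ?R")
proof -
  \<comment> \<open>The point \<open>(X, Y)\<close> is the intersection of circle and ellipse in the
    first quadrant.\<close>
  define X Y where "X = sqrt ((1 - b\<^sup>2) / (a\<^sup>2 - b\<^sup>2))" and "Y = sqrt ((a\<^sup>2 - 1) / (a\<^sup>2 - b\<^sup>2))"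
  define h where "h x = (if \<bar>x\<bar> \<le> X then sqrt (1 - x\<^sup>2) else sqrt (1 - (a * x)\<^sup>2) / b)" for x
  have sq: "a\<^sup>2 > 1" "b\<^sup>2 < 1" "0 < b\<^sup>2"
    using ab by (simp_all add: one_less_power power_less_one_iff abs_square_less_1)
  have X2: "X\<^sup>2 = (1 - b\<^sup>2) / (a\<^sup>2 - b\<^sup>2)" and Y2: "Y\<^sup>2 = (a\<^sup>2 - 1) / (a\<^sup>2 - b\<^sup>2)"
    and X0: "X > 0" and Y0: "Y > 0"
    using sq by (simp_all add: X_def Y_def)
  have "1 - X\<^sup>2 = Y\<^sup>2" using sq by (simp add: X2 Y2 field_simps)
  then have Y_eq: "sqrt (1 - X\<^sup>2) = Y" using Y0 by simp
  have bY2: "1 - (a * X)\<^sup>2 = (b * Y)\<^sup>2" using sq by (simp add: power_mult_distrib X2 Y2 field_simps)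
  have bY_eq: "sqrt (1 - (a * X)\<^sup>2) = b * Y"
    unfolding bY2 using Y0 ab by simp
  have "(a * X)\<^sup>2 \<le> 1"
    using bY2 zero_le_power2[of "b * Y"] by linarith
  then have aX: "a * X \<le> 1"
    using X0 ab by (simp add: abs_square_le_1)
  then have X_le: "X \<le> 1 / a" using ab by (simp add: field_simps)
  have "1 / a < 1" using ab by simp
  with X_le have X_lt: "X < 1" by linarith
  have asq: "arcsin X = arccos Y"
    using X0 X_lt by (simp add: arcsin_arccos_sqrt_pos Y_eq)
  have slice: "{y. x\<^sup>2 + y\<^sup>2 \<le> 1 \<and> a\<^sup>2 * x\<^sup>2 + b\<^sup>2 * y\<^sup>2 \<le> 1} = (if \<bar>x\<bar> \<le> 1 / a then {- h x..h x} else {})"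
    and h_nonneg: "\<bar>x\<bar> \<le> 1 / a \<Longrightarrow> 0 \<le> h x" for x
  proof -
    \<comment> \<open>Since \<open>a\<^sup>2 * x\<^sup>2 + b\<^sup>2 * y\<^sup>2 = b\<^sup>2 *
      (x\<^sup>2 + y\<^sup>2) + (a\<^sup>2 - b\<^sup>2) * x\<^sup>2\<close>, this inequality decides
      which of the two constraints implies the other.\<close>
    have cross: "\<bar>x\<bar> \<le> X \<longleftrightarrow> x\<^sup>2 * (a\<^sup>2 - b\<^sup>2) \<le> 1 - b\<^sup>2"
    proof -
      have "\<bar>x\<bar> \<le> X \<longleftrightarrow> x\<^sup>2 \<le> X\<^sup>2"
        using X0 by (metis abs_ge_zero abs_le_square_iff abs_of_pos)
      then show ?thesis using sq by (simp add: X2 pos_le_divide_eq)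
    qed
    have out: "\<bar>x\<bar> \<le> 1 / a \<longleftrightarrow> a\<^sup>2 * x\<^sup>2 \<le> 1"
    proof -
      have "\<bar>x\<bar> \<le> 1 / a \<longleftrightarrow> \<bar>a * x\<bar> \<le> 1" using ab by (simp add: abs_mult field_simps)
      also have "\<dots> \<longleftrightarrow> (a * x)\<^sup>2 \<le> 1" by (simp add: abs_square_le_1)
      finally show ?thesis by (simp add: power_mult_distrib)
    qed
    have one: "a\<^sup>2 * x\<^sup>2 \<le> 1 \<Longrightarrow> x\<^sup>2 \<le> 1"
      using mult_right_mono[of 1 "a\<^sup>2" "x\<^sup>2"] sq by simp
    show "0 \<le> h x" if "\<bar>x\<bar> \<le> 1 / a"
      using that one ab unfolding out by (simp add: h_def power_mult_distrib)
    show "{y. x\<^sup>2 + y\<^sup>2 \<le> 1 \<and> a\<^sup>2 * x\<^sup>2 + b\<^sup>2 * y\<^sup>2 \<le> 1} = (if \<bar>x\<bar> \<le> 1 / a then {- h x..h x} else {})"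
    proof (cases "a\<^sup>2 * x\<^sup>2 \<le> 1")
      case True
      have sqrt_iff: "\<bar>z\<bar> \<le> sqrt w \<longleftrightarrow> z\<^sup>2 \<le> w" for z w :: real
        by (metis real_sqrt_abs real_sqrt_le_iff)
      have "x\<^sup>2 + y\<^sup>2 \<le> 1 \<and> a\<^sup>2 * x\<^sup>2 + b\<^sup>2 * y\<^sup>2 \<le> 1 \<longleftrightarrow> \<bar>y\<bar> \<le> h x" for y
      proof (cases "\<bar>x\<bar> \<le> X")
        case inner: True
        have "a\<^sup>2 * x\<^sup>2 + b\<^sup>2 * y\<^sup>2 \<le> 1" if "x\<^sup>2 + y\<^sup>2 \<le> 1"
        proof -
          have "b\<^sup>2 * (x\<^sup>2 + y\<^sup>2) \<le> b\<^sup>2" using that sq by (simp add: mult_left_le)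
          then show ?thesis using inner unfolding cross by (simp add: algebra_simps)
        qed
        then show ?thesis using inner by (auto simp: h_def sqrt_iff)
      next
        case outer: False
        have "x\<^sup>2 + y\<^sup>2 \<le> 1" if "a\<^sup>2 * x\<^sup>2 + b\<^sup>2 * y\<^sup>2 \<le> 1"
        proof -
          have "b\<^sup>2 * (x\<^sup>2 + y\<^sup>2) \<le> b\<^sup>2 * 1" using that outer unfolding cross by (simp add: algebra_simps)
          then show ?thesis using sq(3) by (rule mult_left_le_imp_le)
        qed
        moreover have "\<bar>y\<bar> \<le> sqrt (1 - (a * x)\<^sup>2) / b \<longleftrightarrow> a\<^sup>2 * x\<^sup>2 + b\<^sup>2 * y\<^sup>2 \<le> 1"
        proof -
          have "\<bar>y\<bar> \<le> sqrt (1 - (a * x)\<^sup>2) / b \<longleftrightarrow> \<bar>b * y\<bar> \<le> sqrt (1 - (a * x)\<^sup>2)"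
            using ab by (simp add: abs_mult field_simps)
          then show ?thesis by (simp add: sqrt_iff power_mult_distrib algebra_simps)
        qed
        ultimately show ?thesis using outer by (auto simp: h_def)
      qed
      moreover have "{y. \<bar>y\<bar> \<le> h x} = {- h x..h x}"
        by (auto simp: abs_le_iff)
      ultimately show ?thesis using True by (simp only: out if_True)
    next
      case False
      then have "\<not> a\<^sup>2 * x\<^sup>2 + b\<^sup>2 * y\<^sup>2 \<le> 1" for y
        using zero_le_mult_iff[of "b\<^sup>2" "y\<^sup>2"] by (smt (verit) zero_le_power2)
      then show ?thesis using False by (simp add: out)
    qed
  qed
  have integral: "((\<lambda>x. 2 * h x) has_integral ?R) {-(1/a)..1/a}"
  proof -
    \<comment> \<open>The integral of \<open>h\<close> over either outer interval;
      \<open>pi / 2\<close> is the value \<open>arcsin 1\<close> at the vertex of the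
      ellipse.\<close>
    let ?o = "(- (a * X * (b * Y)) - arcsin (a * X) + pi / 2) / (2 * a * b)"
    have o_eq: "?o = (pi / 2 - (a * X * (b * Y) + arcsin (a * X))) / (2 * a * b)"
      by (simp add: algebra_simps)
    have aX': "-1 \<le> a * X"
      using mult_pos_pos[of a X] X0 ab by linarith
    have i1: "(h has_integral ?o) {-(1/a)..-X}"
    \<comment> \<open>At the crossing abscissa itself \<open>h\<close> is given by its circular
      branch, so this one point is exempted.\<close>
    proof (rule has_integral_spike_finite[where S = "{-X}"])
      show "((\<lambda>x. sqrt (1 - (a * x)\<^sup>2) / b) has_integral ?o) {-(1/a)..-X}"
        using has_integral_divide[OF has_integral_sqrt_one_minus_square[of a "-(1/a)" "-X"], of b] ab X_le aX aX' bY_eq X0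
        by (simp add: arcsin_minus)
    qed (use X0 in \<open>auto simp: h_def\<close>)
    have i2: "(h has_integral (X * Y + arcsin X)) {-X..X}"
    proof (rule has_integral_eq)
      show "((\<lambda>x. sqrt (1 - x\<^sup>2)) has_integral (X * Y + arcsin X)) {-X..X}"
        using has_integral_sqrt_one_minus_square[of 1 "-X" X] X0 X_lt Y_eq
        by (simp add: arcsin_minus add_divide_distrib)
    qed (auto simp: h_def)
    have i3: "(h has_integral ?o) {X..1/a}"
    proof (rule has_integral_spike_finite[where S = "{X}"])
      show "((\<lambda>x. sqrt (1 - (a * x)\<^sup>2) / b) has_integral ?o) {X..1/a}"
        using has_integral_divide[OF has_integral_sqrt_one_minus_square[of a X "1/a"], of b] ab X_le aX aX' bY_eq X0
        unfolding o_eq by simp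
    qed (use X0 in \<open>auto simp: h_def\<close>)
    have "(h has_integral (?o + (X * Y + arcsin X) + ?o)) {-(1/a)..1/a}"
      using X0 X_le by (intro has_integral_combine[OF _ _ has_integral_combine[OF _ _ i1 i2] i3]) auto
    from has_integral_mult_right[OF this, of 2]
    have "((\<lambda>x. 2 * h x) has_integral 2 * (?o + (X * Y + arcsin X) + ?o)) {-(1/a)..1/a}" .
    \<comment> \<open>The products \<open>X * Y\<close> from the circular and the elliptic pieces
      cancel, which leaves only the inverse trigonometric terms.\<close>
    moreover have "2 * (?o + (X * Y + arcsin X) + ?o) = ?R"
    proof -
      have "arccos (a * X) = pi / 2 - arcsin (a * X)"
        using aX aX' by (simp add: arccos_arcsin_eq)
      then have o_arccos: "?o = (arccos (a * X) - a * X * (b * Y)) / (2 * a * b)"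
        by simp
      show ?thesis
        unfolding o_arccos X_def[symmetric] Y_def[symmetric] asq[symmetric] using ab by (simp add: field_simps)
    qed
    ultimately show ?thesis by simp
  qed
  have R_nonneg: "?R \<ge> 0"
    by (rule has_integral_nonneg[OF integral]) (simp add: h_nonneg abs_le_iff)
  let ?f = "\<lambda>(x, y). vector [x, y] :: real^2"
  have S_borel: "?S \<in> sets borel"
    by (intro borel_closed closed_Collect_conj closed_Collect_le continuous_intros)
  \<comment> \<open>Transported to the product measure, the area becomes the integral of the slice
    lengths \<open>2 * h x\<close>.\<close>
  define P where "P = ?f -` ?S"
  have P_sets: "P \<in> sets (lborel \<Otimes>\<^sub>M lborel)"
    using measurable_sets[OF measurable_vector_2 S_borel] by (simp add: P_def space_pair_measure)
  have "emeasure lborel ?S = emeasure (lborel \<Otimes>\<^sub>M lborel) P"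
    unfolding lborel_vec_2_eq_distr P_def by (subst emeasure_distr[OF measurable_vector_2 S_borel]) (simp add: space_pair_measure)
  also have "\<dots> = (\<integral>\<^sup>+x. emeasure lborel (Pair x -` P) \<partial>lborel)"
    by (rule lborel.emeasure_pair_measure_alt[OF P_sets])
  also have "\<dots> = (\<integral>\<^sup>+x. ennreal (indicator {-(1/a)..1/a} x * (2 * h x)) \<partial>lborel)"
  proof (rule nn_integral_cong)
    fix x :: real
    have "Pair x -` P = {y. x\<^sup>2 + y\<^sup>2 \<le> 1 \<and> a\<^sup>2 * x\<^sup>2 + b\<^sup>2 * y\<^sup>2 \<le> 1}"
      by (auto simp: P_def)
    then show "emeasure lborel (Pair x -` P) = ennreal (indicator {-(1/a)..1/a} x * (2 * h x))"
      using h_nonneg[of x] by (auto simp: slice indicator_def abs_le_iff)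
  qed
  also have "\<dots> = ennreal ?R"
    using nn_integral_has_integral_lebesgue[OF _ integral] h_nonneg by (simp add: abs_le_iff)
  finally have "emeasure lborel ?S = ennreal ?R" .
  then show ?thesis
    using R_nonneg S_borel by (simp add: measure_def emeasure_completion)
qed

text \<open>The ellipse is the image of the unit disk under the diagonal map with entries
  \<open>1 / a\<close> and \<open>1 / b\<close>, whose determinant scales the area
  \<open>pi\<close>.\<close>

lemma measure_ellipse:
  fixes a b :: real
  assumes ab: "a > 0" "b > 0"
  shows "measure lebesgue {v::real^2. a\<^sup>2 * (v$1)\<^sup>2 + b\<^sup>2 * (v$2)\<^sup>2 \<le> 1} = pi / (a * b)"
    (is "measure lebesgue ?E = _")
proof -
  define m where "m = (\<lambda>i::2. if i = 1 then 1 / a else 1 / b)"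
  have m: "m 1 = 1 / a" "m 2 = 1 / b"
    by (simp_all add: m_def)
  have norm_le: "norm v \<le> 1 \<longleftrightarrow> (v$1)\<^sup>2 + (v$2)\<^sup>2 \<le> 1" for v :: "real^2"
    by (simp add: norm_le_square inner_vec_def sum_2 flip: power2_eq_square)
  have "?E = (\<lambda>v. \<chi> i. m i * v$i) ` cball 0 1"
  proof (intro equalityI subsetI)
    fix v :: "real^2" assume v: "v \<in> ?E"
    define w :: "real^2" where "w = vector [a * v$1, b * v$2]"
    have "w \<in> cball 0 1"
      using v by (simp add: norm_le w_def power_mult_distrib)
    moreover have "v = (\<chi> i. m i * w$i)"
      using ab by (simp add: vec_eq_iff forall_2 m w_def)
    ultimately show "v \<in> (\<lambda>v. \<chi> i. m i * v$i) ` cball 0 1" by blast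
  next
    fix v assume "v \<in> (\<lambda>v. \<chi> i. m i * v$i) ` cball (0::real^2) 1"
    then show "v \<in> ?E"
      using ab by (auto simp: norm_le m power_mult_distrib power_divide)
  qed
  then have "measure lebesgue ?E = \<bar>prod m UNIV\<bar> * measure lebesgue (cball (0::real^2) 1)"
    by (simp only: measure_stretch[OF lmeasurable_cball])
  also have "\<dots> = pi / (a * b)"
    using ab by (simp add: UNIV_2 m content_cball unit_ball_vol_2)
  finally show ?thesis .
qed

text \<open>Passing to a right singular basis is a rotation: it preserves norm and area and
  diagonalises the second constraint. Injectivity of \<open>A\<close> makes the smaller singular
  value positive.\<close>

lemma measure_cball_inter_linear_vimage:
  fixes A :: "real^2 \<Rightarrow> 'b::euclidean_space"
  assumes A: "linear A" "inj A" and c: "c > 0"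
  obtains s1 s2 where "singular_values A = [s1, s2]" "s1 \<ge> s2" "s2 > 0"
    "measure lebesgue {v. norm v \<le> 1 \<and> c * norm (A v) \<le> 1} =
     measure lebesgue {v::real^2. (v$1)\<^sup>2 + (v$2)\<^sup>2 \<le> 1 \<and> (c * s1)\<^sup>2 * (v$1)\<^sup>2 + (c * s2)\<^sup>2 * (v$2)\<^sup>2 \<le> 1}"
proof -
  obtain \<theta> where \<theta>: "A (rot_basis \<theta>) \<bullet> A (rot_basis (\<theta> + pi/2)) = 0"
    "norm (A (rot_basis \<theta>)) \<ge> norm (A (rot_basis (\<theta> + pi/2)))"
    using exists_orthogonal_image_basis[OF A(1)] by blast
  define s1 s2 where "s1 = norm (A (rot_basis \<theta>))" "s2 = norm (A (rot_basis (\<theta> + pi/2)))"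
  have "rot_basis (\<theta> + pi/2) \<noteq> 0"
    using inner_rot_basis(2)[of \<theta>] by fastforce
  then have "A (rot_basis (\<theta> + pi/2)) \<noteq> 0"
    using A linear_injective_0 by metis
  then have "s2 > 0"
    by (simp add: s1_s2_def)
  define S :: "(real^2) set" where
    "S = {v. (v$1)\<^sup>2 + (v$2)\<^sup>2 \<le> 1 \<and> (c * s1)\<^sup>2 * (v$1)\<^sup>2 + (c * s2)\<^sup>2 * (v$2)\<^sup>2 \<le> 1}"
  have norm_le: "norm v \<le> 1 \<longleftrightarrow> (v$1)\<^sup>2 + (v$2)\<^sup>2 \<le> 1" for v :: "real^2"
    by (simp add: norm_le_square inner_vec_def sum_2 flip: power2_eq_square)
  have "closed S"
    unfolding S_def by (intro closed_Collect_conj closed_Collect_le continuous_intros)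
  moreover have "bounded S"
    by (rule bounded_subset[of "cball 0 1"]) (auto simp: S_def norm_le)
  ultimately have S: "S \<in> lmeasurable"
    by (simp add: lmeasurable_compact compact_eq_bounded_closed)
  have "norm (rot_map \<theta> u) \<le> 1 \<and> c * norm (A (rot_map \<theta> u)) \<le> 1 \<longleftrightarrow> u \<in> S" for u
  proof -
    have "norm (rot_map \<theta> u) = norm u"
      by (rule orthogonal_transformation_norm[OF orthogonal_transformation_rot_map])
    moreover have "c * norm (A (rot_map \<theta> u)) \<le> 1 \<longleftrightarrow> (c * norm (A (rot_map \<theta> u)))\<^sup>2 \<le> 1"
      using c by (simp add: abs_square_le_1)
    ultimately show ?thesis
      by (simp add: S_def norm_le power_mult_distrib norm_image_rot_map[OF A(1) \<theta>(1)] distrib_left mult.assoc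
          flip: s1_s2_def)
  qed
  then have "{v. norm v \<le> 1 \<and> c * norm (A v) \<le> 1} = rot_map \<theta> ` S"
    by (auto intro: rot_map_surjE) (metis imageI rot_map_surjE)
  then have "measure lebesgue {v. norm v \<le> 1 \<and> c * norm (A v) \<le> 1} = measure lebesgue S"
    by (simp add: measure_orthogonal_image[OF orthogonal_transformation_rot_map S])
  with singular_values_eq_norm_rot_basis[OF A(1) \<theta>] \<open>s2 > 0\<close> show ?thesis
    using that[of s1 s2] \<theta>(2) by (simp add: s1_s2_def S_def)
qed

section \<open>Derivative of the system and evaluation of the entropy\<close>

text \<open>The map \<open>\<phi> s t\<close> is a differentiable left inverse of
  \<open>\<phi> t s\<close> on the open set \<open>X s\<close>, so by the chain rule its derivative
  is a left inverse of \<open>A\<close>.\<close>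

lemma C2_nds_inj_derivative:
  assumes nds: "C2_nds J X \<phi>" and J: "s \<in> J" "t \<in> J" and x: "x \<in> X s"
    and deriv: "(\<phi> t s has_derivative A) (at x)"
  shows "inj A"
proof -
  have X: "open (X s)" and inv: "\<And>y. y \<in> X s \<Longrightarrow> \<phi> s t (\<phi> t s y) = y" and "\<phi> t s x \<in> X t"
    using nds J x unfolding C2_nds_def by (auto simp: Pi_iff)
  have "C2_on (\<phi> s t) (X t)"
    using nds J unfolding C2_nds_def by blast
  then obtain B where "(\<phi> s t has_derivative B) (at (\<phi> t s x))"
    using \<open>\<phi> t s x \<in> X t\<close> unfolding C2_on_def by blast
  from diff_chain_at[OF deriv this] have "((\<phi> s t \<circ> \<phi> t s) has_derivative (B \<circ> A)) (at x)" .
  moreover have "((\<phi> s t \<circ> \<phi> t s) has_derivative id) (at x)"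
    by (rule has_derivative_transform_within_open[OF has_derivative_id[folded id_def] X x]) (simp add: inv)
  ultimately have "B \<circ> A = id"
    by (rule has_derivative_unique)
  then show ?thesis
    by (metis inj_on_id inj_on_imageI2)
qed

theorem proposition13:
  fixes t0 T \<alpha> \<kappa>1 \<kappa>2 :: real
    and J :: "real set"
    and X :: "real \<Rightarrow> (real^2) set"
    and \<phi> :: "real \<Rightarrow> real \<Rightarrow> real^2 \<Rightarrow> real^2"
    and x0 :: "real^2"
  assumes "T > 0"
    and "J = {t0, t0 + T}"
    and "C2_nds J X \<phi>"
    and "x0 \<in> X t0"
    and "\<kappa>1 = exp ((ftle \<phi> 1 t0 x0 T - \<alpha>) * T)"
    and "\<kappa>2 = exp ((ftle \<phi> 2 t0 x0 T - \<alpha>) * T)"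
  shows "\<kappa>1 \<ge> \<kappa>2 \<and> \<kappa>2 > 0 \<and>
    (1 \<ge> \<kappa>1 \<and> \<kappa>1 \<ge> \<kappa>2 \<longrightarrow> ftme J X \<phi> \<alpha> t0 x0 = 0) \<and>
    (\<kappa>1 > 1 \<and> 1 > \<kappa>2 \<longrightarrow>
      ftme J X \<phi> \<alpha> t0 x0 =
        ereal (- (1 / T) * ln (2 / pi *
          (arccos (sqrt ((\<kappa>1\<^sup>2 - 1) / (\<kappa>1\<^sup>2 - \<kappa>2\<^sup>2))) +
           1 / (\<kappa>1 * \<kappa>2) * arccos (\<kappa>1 * sqrt ((1 - \<kappa>2\<^sup>2) / (\<kappa>1\<^sup>2 - \<kappa>2\<^sup>2))))))) \<and>
    (\<kappa>1 \<ge> \<kappa>2 \<and> \<kappa>2 \<ge> 1 \<longrightarrow>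
      ftme J X \<phi> \<alpha> t0 x0 = ereal (- (1 / T) * ln (1 / (\<kappa>1 * \<kappa>2))))"
proof -
  note T = assms(1) and J = assms(2) and nds = assms(3) and x0 = assms(4)
  define f where "f = \<phi> (t0 + T) t0"
  define c where "c = exp (- \<alpha> * T)"
  have c: "c > 0" by (simp add: c_def)
  have tJ: "t0 \<in> J" "t0 + T \<in> J" by (simp_all add: J)
  have X: "open (X t0)" and id: "\<And>x. x \<in> X t0 \<Longrightarrow> \<phi> t0 t0 x = x" and C2: "C2_on f (X t0)"
    using nds tJ unfolding C2_nds_def f_def by blast+
  have diff: "f differentiable (at x)" if "x \<in> X t0" for x
    using C2 that unfolding C2_on_def differentiable_def by blast
  then have cont: "continuous_on (X t0) f"
    by (meson continuous_at_imp_continuous_on differentiable_imp_continuous_within)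
  define A where "A = frechet_derivative f (at x0)"
  have deriv: "(f has_derivative A) (at x0)"
    using diff[OF x0] by (simp add: A_def frechet_derivative_works)
  then have "linear A" by (rule has_derivative_linear)
  moreover have "inj A"
    using C2_nds_inj_derivative[OF nds tJ x0] deriv by (simp add: f_def)
  ultimately obtain s1 s2 where sv: "singular_values A = [s1, s2]" and s: "s1 \<ge> s2" "s2 > 0"
    and area: "measure lebesgue {v. norm v \<le> 1 \<and> c * norm (A v) \<le> 1} =
      measure lebesgue {v::real^2. (v$1)\<^sup>2 + (v$2)\<^sup>2 \<le> 1 \<and> (c * s1)\<^sup>2 * (v$1)\<^sup>2 + (c * s2)\<^sup>2 * (v$2)\<^sup>2 \<le> 1}"
    using measure_cball_inter_linear_vimage c by blast
  \<comment> \<open>The exponential undoes the logarithm in the Lyapunov exponent, so each \<kappa>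
    is a singular value times the weight \<open>c\<close>; positivity of the singular value is
    essential for \<open>ln\<close>.\<close>
  have \<kappa>_eq: "exp ((1 / T * ln r - \<alpha>) * T) = c * r" if "r > 0" for r
  proof -
    have "(1 / T * ln r - \<alpha>) * T = - \<alpha> * T + ln r" using T by (simp add: algebra_simps)
    then show ?thesis using that by (simp only: c_def exp_add exp_ln)
  qed
  have \<kappa>: "\<kappa>1 = c * s1" "\<kappa>2 = c * s2"
    using assms(5,6) \<kappa>_eq[of s1] \<kappa>_eq[of s2] s by (simp_all add: ftle_def sv flip: f_def A_def)
  have \<kappa>_ord: "\<kappa>1 \<ge> \<kappa>2" "\<kappa>2 > 0"
    using s c by (simp_all add: \<kappa>)
  define E :: "(real^2) set" where
    "E = {v. (v$1)\<^sup>2 + (v$2)\<^sup>2 \<le> 1 \<and> \<kappa>1\<^sup>2 * (v$1)\<^sup>2 + \<kappa>2\<^sup>2 * (v$2)\<^sup>2 \<le> 1}"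
  \<comment> \<open>The supremum is a maximum of two terms. At time \<open>t0\<close> the weight is
    1 and the map is the identity; at time \<open>t0 + T\<close> the weight is
    \<open>c\<close>.\<close>
  have dyn_ball: "dyn_ball J X \<phi> \<alpha> t0 x0 \<epsilon> =
      {x \<in> X t0. norm (x - x0) \<le> \<epsilon> \<and> c * norm (f x - f x0) \<le> \<epsilon>}" for \<epsilon>
    unfolding dyn_ball_def J
    by (auto simp: cSup_insert_If sup_real_def id x0 c_def f_def mult.commute)
  \<comment> \<open>The quotient of measures converges to \<open>r / pi\<close>, where
    \<open>pi\<close> is the area of the unit disk. As this limit is positive, \<open>ln\<close> is
    continuous there and the limsup is a limit.\<close>
  have ftme: "ftme J X \<phi> \<alpha> t0 x0 = ereal (- (1 / T) * ln (r / pi))"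
    if E: "measure lebesgue E = r" and "r > 0" for r
  proof -
    have "Max J - Min J = T" using T by (simp add: J)
    moreover have "((\<lambda>\<epsilon>. measure lebesgue (dyn_ball J X \<phi> \<alpha> t0 x0 \<epsilon>) / measure lebesgue (cball x0 \<epsilon>))
        \<longlongrightarrow> r / pi) (at_right 0)"
      using tendsto_measure_ratio_ball_inter[OF X x0 cont deriv c] E
      by (simp add: dyn_ball area E_def \<kappa> content_cball unit_ball_vol_2)
    ultimately show ?thesis
      unfolding ftme_def using \<open>r > 0\<close> T
      by (intro lim_imp_Limsup) (auto intro!: tendsto_intros)
  qed
  have le_mult: "k\<^sup>2 * x \<le> x" if "0 \<le> k" "k \<le> 1" "x \<ge> 0" for k x :: real
    using that by (simp add: mult_left_le_one_le power_le_one)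
  have ge_mult: "x \<le> k\<^sup>2 * x" if "k \<ge> 1" "x \<ge> 0" for k x :: real
    using mult_right_mono[of 1 "k\<^sup>2" x] that by simp
  have "ftme J X \<phi> \<alpha> t0 x0 = 0" if "\<kappa>1 \<le> 1"
  proof -
    have "\<kappa>1\<^sup>2 * (v$1)\<^sup>2 + \<kappa>2\<^sup>2 * (v$2)\<^sup>2 \<le> (v$1)\<^sup>2 + (v$2)\<^sup>2" for v :: "real^2"
      using \<kappa>_ord that by (intro add_mono le_mult) auto
    \<comment> \<open>With both \<kappa> at most 1, the unit disk lies inside the ellipse.\<close>
    then have "E = {v. (v$1)\<^sup>2 + (v$2)\<^sup>2 \<le> 1}"
      unfolding E_def by (auto intro: order_trans)
    then have "measure lebesgue E = pi"
      using measure_ellipse[of 1 1] by simp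
    then show ?thesis using ftme[of pi] by simp
  qed
  moreover have "ftme J X \<phi> \<alpha> t0 x0 = ereal (- (1 / T) * ln (1 / (\<kappa>1 * \<kappa>2)))" if "\<kappa>2 \<ge> 1"
  proof -
    have "(v$1)\<^sup>2 + (v$2)\<^sup>2 \<le> \<kappa>1\<^sup>2 * (v$1)\<^sup>2 + \<kappa>2\<^sup>2 * (v$2)\<^sup>2" for v :: "real^2"
      using \<kappa>_ord that by (intro add_mono ge_mult) auto
    \<comment> \<open>With both \<kappa> at least 1, the ellipse lies inside the unit disk.\<close>
    then have "E = {v. \<kappa>1\<^sup>2 * (v$1)\<^sup>2 + \<kappa>2\<^sup>2 * (v$2)\<^sup>2 \<le> 1}"
      unfolding E_def by (auto intro: order_trans)
    then have "measure lebesgue E = pi / (\<kappa>1 * \<kappa>2)"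
      using measure_ellipse[of \<kappa>1 \<kappa>2] \<kappa>_ord by simp
    then show ?thesis using ftme[of "pi / (\<kappa>1 * \<kappa>2)"] \<kappa>_ord by simp
  qed
  moreover have "ftme J X \<phi> \<alpha> t0 x0 =
        ereal (- (1 / T) * ln (2 / pi *
          (arccos (sqrt ((\<kappa>1\<^sup>2 - 1) / (\<kappa>1\<^sup>2 - \<kappa>2\<^sup>2))) +
           1 / (\<kappa>1 * \<kappa>2) * arccos (\<kappa>1 * sqrt ((1 - \<kappa>2\<^sup>2) / (\<kappa>1\<^sup>2 - \<kappa>2\<^sup>2))))))"
    if "\<kappa>1 > 1" "\<kappa>2 < 1"
  proof -
    have meas: "measure lebesgue E = 2 * (arccos (sqrt ((\<kappa>1\<^sup>2 - 1) / (\<kappa>1\<^sup>2 - \<kappa>2\<^sup>2))) +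
           1 / (\<kappa>1 * \<kappa>2) * arccos (\<kappa>1 * sqrt ((1 - \<kappa>2\<^sup>2) / (\<kappa>1\<^sup>2 - \<kappa>2\<^sup>2))))"
      unfolding E_def using that \<kappa>_ord by (intro measure_disk_inter_ellipse) auto
    have sq: "\<kappa>1\<^sup>2 > 1" "\<kappa>2\<^sup>2 < 1" "\<kappa>2\<^sup>2 > 0"
      using that \<kappa>_ord by (simp_all add: abs_square_less_1)
    \<comment> \<open>The area must be shown positive before taking \<open>ln\<close>: the first
      \<open>arccos\<close> is positive because \<open>p < 1\<close>, the second nonnegative because
      its argument lies between -1 and 1.\<close>
    define p q where "p = (\<kappa>1\<^sup>2 - 1) / (\<kappa>1\<^sup>2 - \<kappa>2\<^sup>2)" and "q = (1 - \<kappa>2\<^sup>2) / (\<kappa>1\<^sup>2 - \<kappa>2\<^sup>2)"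
    have "0 < p" "p < 1" "0 < q"
      using sq by (simp_all add: p_def q_def)
    then have "arccos (sqrt p) > 0"
      using arccos_lt_bounded[of "sqrt p"] real_sqrt_gt_zero[of p] real_sqrt_lt_1_iff[of p] by linarith
    moreover have "arccos (\<kappa>1 * sqrt q) \<ge> 0"
    proof (rule arccos_lbound)
      have "\<kappa>1\<^sup>2 * (1 - \<kappa>2\<^sup>2) \<le> \<kappa>1\<^sup>2 - \<kappa>2\<^sup>2"
        using mult_right_mono[of 1 "\<kappa>1\<^sup>2" "\<kappa>2\<^sup>2"] sq by (simp add: algebra_simps)
      then have "\<kappa>1\<^sup>2 * q \<le> 1"
        using sq by (simp add: q_def)
      then have "sqrt (\<kappa>1\<^sup>2 * q) \<le> 1" by simp
      then show "\<kappa>1 * sqrt q \<le> 1"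
        using that by (simp add: real_sqrt_mult)
      have "0 \<le> \<kappa>1 * sqrt q"
        using that \<open>0 < q\<close> by simp
      then show "-1 \<le> \<kappa>1 * sqrt q" by linarith
    qed
    ultimately have "measure lebesgue E > 0"
      unfolding meas using \<kappa>_ord by (simp add: add_pos_nonneg flip: p_def q_def)
    from ftme[OF meas this[unfolded meas]] show ?thesis by simp
  qed
  ultimately show ?thesis using \<kappa>_ord by blast
qed

end
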